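(* Let $R$ be a commutative ring with identity, $M$ an $R$-module, and let $\psi: S(M)\to S(M)\cup\{\emptyset\}$ and $\phi: S(R)\to S(R)\cup\{\emptyset\}$ be functions, where $S(M)$ is the set of submodules of $M$ and $S(R)$ the set of ideals of $R$. (a) If $S$ is a $\psi$-second submodule of $M$ such that $Ann_R(\psi(S))\subseteq \phi(Ann_R(S))$, then $Ann_R(S)$ is a $\phi$-prime ideal of $R$. (b) If $M$ is a comultiplication $R$-module, $S$ is a submodule of $M$ such that $\psi(S)=(0:_M \phi(Ann_R(S)))$, and $Ann_R(S)$ is a $\phi$-prime ideal of $R$, then $S$ is a $\psi$-second submodule of $M$.
   Context: For a subset $X\subseteq M$, $Ann_R(X)=\{r\in R: rx=0 \text{ for all } x\in X\}$; for a subset $A\subseteq R$, $(0:_M A)=\{m\in M: am=0 \text{ for all } a\in A\}$ (both read literally also when the subset is $\emptyset$), and $r\emptyset=\emptyset$. A non-zero submodule $N$ of $M$ is $\psi$-second if for all $r\in R$ and all submodules $K$ of $M$ with $rN\subseteq K$ and $r\psi(N)\not\subseteq K$, one has $N\subseteq K$ or $rN=0$. A proper ideal $P$ of $R$ is $\phi$-prime if for all $r,s\in R$, $rs\in P\setminus\phi(P)$ implies $r\in P$ or $s\in P$. An $R$-module $M$ is a comultiplication module if for every submodule $N$ of $M$ there is an ideal $I$ of $R$ with $N=(0:_M I)$; equivalently, $N=(0:_M Ann_R(N))$ for every submodule $N$ of $M$. *)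

theory Defs
  imports "HOL-Algebra.Module" "HOL-Algebra.Ideal" "HOL-Library.FuncSet"
begin

definition submodules :: "('a, 'r) ring_scheme \<Rightarrow> ('a, 'b, 'm) module_scheme \<Rightarrow> 'b set set"
  where "submodules R M = {N. submodule N R M}"

definition ideals :: "('a, 'r) ring_scheme \<Rightarrow> 'a set set"
  where "ideals R = {I. ideal I R}"

text \<open>The next two are also applied to the empty set, where they return all of
  \<open>carrier R\<close> and all of \<open>carrier M\<close> respectively.\<close>

definition Ann :: "('a, 'r) ring_scheme \<Rightarrow> ('a, 'b, 'm) module_scheme \<Rightarrow> 'b set \<Rightarrow> 'a set"
  where "Ann R M X = {r \<in> carrier R. \<forall>x\<in>X. r \<odot>\<^bsub>M\<^esub> x = \<zero>\<^bsub>M\<^esub>}"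

text \<open>\<open>annihilated M A\<close> is $(0 :_M A)$.\<close>

definition annihilated :: "('a, 'b, 'm) module_scheme \<Rightarrow> 'a set \<Rightarrow> 'b set"
  where "annihilated M A = {m \<in> carrier M. \<forall>a\<in>A. a \<odot>\<^bsub>M\<^esub> m = \<zero>\<^bsub>M\<^esub>}"

definition scale_set :: "('a, 'b, 'm) module_scheme \<Rightarrow> 'a \<Rightarrow> 'b set \<Rightarrow> 'b set"
  where "scale_set M r X = (\<lambda>x. r \<odot>\<^bsub>M\<^esub> x) ` X"

definition psi_second ::
    "('a, 'r) ring_scheme \<Rightarrow> ('a, 'b, 'm) module_scheme \<Rightarrow> ('b set \<Rightarrow> 'b set) \<Rightarrow> 'b set \<Rightarrow> bool"
  where "psi_second R M \<psi> N \<longleftrightarrow>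
    submodule N R M \<and> N \<noteq> {\<zero>\<^bsub>M\<^esub>} \<and>
    (\<forall>r\<in>carrier R. \<forall>K\<in>submodules R M.
       scale_set M r N \<subseteq> K \<and> \<not> scale_set M r (\<psi> N) \<subseteq> K \<longrightarrow>
       N \<subseteq> K \<or> scale_set M r N = {\<zero>\<^bsub>M\<^esub>})"

definition phi_prime :: "('a, 'r) ring_scheme \<Rightarrow> ('a set \<Rightarrow> 'a set) \<Rightarrow> 'a set \<Rightarrow> bool"
  where "phi_prime R \<phi> P \<longleftrightarrow>
    ideal P R \<and> P \<noteq> carrier R \<and>
    (\<forall>r\<in>carrier R. \<forall>s\<in>carrier R. r \<otimes>\<^bsub>R\<^esub> s \<in> P - \<phi> P \<longrightarrow> r \<in> P \<or> s \<in> P)"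

definition comultiplication_module ::
    "('a, 'r) ring_scheme \<Rightarrow> ('a, 'b, 'm) module_scheme \<Rightarrow> bool"
  where "comultiplication_module R M \<longleftrightarrow>
    module R M \<and> (\<forall>N\<in>submodules R M. \<exists>I\<in>ideals R. N = annihilated M I)"

end

theory Submission
  imports Defs
begin

text \<open>
  For (a), if \<open>r s\<close> kills \<open>S\<close>, test the \<open>\<psi>\<close>-second condition for \<open>s\<close> on the submodule
  \<open>K = (0 :\<^sub>M r)\<close>, which contains \<open>s S\<close>; that it contains \<open>s \<psi>(S)\<close> would mean
  \<open>r s \<in> Ann(\<psi>(S)) \<subseteq> \<phi>(Ann(S))\<close>.
  For (b), write \<open>K = (0 :\<^sub>M I)\<close> with \<open>I\<close> an ideal and put \<open>P = Ann(S)\<close>. Then \<open>r S \<subseteq> K\<close> says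
  \<open>r I \<subseteq> P\<close>, while \<open>r \<psi>(S) \<nsubseteq> K\<close> says \<open>r I \<nsubseteq> \<phi>(P)\<close>. Since \<open>P\<close> is \<open>\<phi>\<close>-prime, this forces
  \<open>r \<in> P\<close> or \<open>I \<subseteq> P\<close>.
\<close>

context module
begin

lemma submodule_zero_mem:
  assumes "submodule N R M"
  shows "\<zero>\<^bsub>M\<^esub> \<in> N"
  using subgroup.one_closed[OF submodule.axioms(1)[OF assms]] by simp

lemma smult_left_commute:
  assumes "a \<in> carrier R" "b \<in> carrier R" "x \<in> carrier M"
  shows "a \<odot>\<^bsub>M\<^esub> (b \<odot>\<^bsub>M\<^esub> x) = b \<odot>\<^bsub>M\<^esub> (a \<odot>\<^bsub>M\<^esub> x)"
  using assms by (metis R.m_comm smult_assoc1)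

lemma Ann_ideal:
  assumes "X \<subseteq> carrier M"
  shows "ideal (Ann R M X) R"
proof (rule idealI)
  show "ring R" by (rule R.ring_axioms)
  show "subgroup (Ann R M X) (add_monoid R)"
  proof (rule R.add.subgroupI)
    have "\<zero> \<in> Ann R M X" using assms by (auto simp: Ann_def)
    then show "Ann R M X \<noteq> {}" by blast
  qed (use assms in \<open>auto simp: Ann_def smult_l_distr smult_l_minus subset_iff simp flip: a_inv_def\<close>)
next
  fix a x assume "a \<in> Ann R M X" "x \<in> carrier R"
  then show "x \<otimes> a \<in> Ann R M X"
    using assms by (auto simp: Ann_def smult_assoc1 subset_iff)
  then show "a \<otimes> x \<in> Ann R M X"
    using \<open>a \<in> Ann R M X\<close> \<open>x \<in> carrier R\<close> by (simp add: Ann_def R.m_comm)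
qed

lemma annihilated_submodule:
  assumes "A \<subseteq> carrier R"
  shows "submodule (annihilated M A) R M"
proof (rule submoduleI)
  fix a x assume "a \<in> carrier R" "x \<in> annihilated M A"
  then show "a \<odot>\<^bsub>M\<^esub> x \<in> annihilated M A"
    using assms by (simp add: annihilated_def subset_iff smult_left_commute[where b = a])
qed (use assms in \<open>auto simp: annihilated_def smult_r_distr smult_r_minus subset_iff\<close>)

text \<open>Only zero is killed by \<open>\<one>\<close>. This matches properness in
  \<open>phi_prime\<close> with being non-zero in \<open>psi_second\<close>.\<close>

lemma Ann_eq_carrier_iff:
  assumes "submodule N R M"
  shows "Ann R M N = carrier R \<longleftrightarrow> N = {\<zero>\<^bsub>M\<^esub>}"
proof
  assume "Ann R M N = carrier R"
  then have "\<one> \<in> Ann R M N" by simp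
  then have "x = \<zero>\<^bsub>M\<^esub>" if "x \<in> N" for x
    using that submoduleE(1)[OF assms] smult_one[of x] unfolding Ann_def by fastforce
  then show "N = {\<zero>\<^bsub>M\<^esub>}" using submodule_zero_mem[OF assms] by blast
qed (auto simp: Ann_def)

text \<open>As \<open>N\<close> contains zero, its image is non-empty, so equality with the zero set
  only asks that \<open>r\<close> kill every element.\<close>

lemma scale_set_eq_zero_iff:
  assumes "submodule N R M" "r \<in> carrier R"
  shows "scale_set M r N = {\<zero>\<^bsub>M\<^esub>} \<longleftrightarrow> r \<in> Ann R M N"
proof -
  have "scale_set M r N \<noteq> {}"
    using submodule_zero_mem[OF assms(1)] by (auto simp: scale_set_def)
  then have "scale_set M r N = {\<zero>\<^bsub>M\<^esub>} \<longleftrightarrow> (\<forall>y\<in>scale_set M r N. y = \<zero>\<^bsub>M\<^esub>)"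
    by auto
  then show ?thesis
    using assms(2) by (simp add: scale_set_def Ann_def)
qed

text \<open>By commutativity, \<open>a\<close> kills \<open>r x\<close> exactly when
  \<open>r \<otimes> a\<close> kills \<open>x\<close>. The set \<open>X\<close> is arbitrary so that
  both \<open>S\<close> and a possibly empty \<open>\<psi> S\<close> are covered.\<close>

lemma scale_set_subset_annihilated_iff:
  assumes "X \<subseteq> carrier M" "r \<in> carrier R" "A \<subseteq> carrier R"
  shows "scale_set M r X \<subseteq> annihilated M A \<longleftrightarrow> (\<forall>a\<in>A. r \<otimes> a \<in> Ann R M X)"
proof -
  have eq: "(r \<otimes> a) \<odot>\<^bsub>M\<^esub> x = a \<odot>\<^bsub>M\<^esub> (r \<odot>\<^bsub>M\<^esub> x)" if "a \<in> A" "x \<in> X" for a x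
    using that assms by (metis R.m_comm smult_assoc1 subsetD)
  have "r \<odot>\<^bsub>M\<^esub> x \<in> carrier M" if "x \<in> X" for x
    using that assms by blast
  then have "scale_set M r X \<subseteq> annihilated M A \<longleftrightarrow>
      (\<forall>x\<in>X. \<forall>a\<in>A. a \<odot>\<^bsub>M\<^esub> (r \<odot>\<^bsub>M\<^esub> x) = \<zero>\<^bsub>M\<^esub>)"
    by (simp add: scale_set_def annihilated_def image_subset_iff)
  also have "\<dots> \<longleftrightarrow> (\<forall>a\<in>A. \<forall>x\<in>X. (r \<otimes> a) \<odot>\<^bsub>M\<^esub> x = \<zero>\<^bsub>M\<^esub>)"
    using eq by (metis (no_types))
  also have "\<dots> \<longleftrightarrow> (\<forall>a\<in>A. r \<otimes> a \<in> Ann R M X)"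
    using assms by (simp add: Ann_def subset_iff)
  finally show ?thesis .
qed

lemma psi_second_imp_phi_prime_Ann:
  assumes second: "psi_second R M \<psi> S" and sub: "\<psi> S \<subseteq> carrier M"
    and Ann: "Ann R M (\<psi> S) \<subseteq> \<phi> (Ann R M S)"
  shows "phi_prime R \<phi> (Ann R M S)"
proof -
  have S: "submodule S R M" "S \<noteq> {\<zero>\<^bsub>M\<^esub>}"
    using second by (auto simp: psi_second_def)
  note SM = submoduleE(1)[OF S(1)]
  have "r \<in> Ann R M S \<or> s \<in> Ann R M S"
    if rs: "r \<in> carrier R" "s \<in> carrier R" "r \<otimes> s \<in> Ann R M S - \<phi> (Ann R M S)" for r s
  proof -
    define K where "K = annihilated M {r}"
    have K: "K \<in> submodules R M"
      using annihilated_submodule[of "{r}"] rs(1) by (simp add: K_def submodules_def)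
    \<comment> \<open>For \<open>S\<close> the right side holds by assumption. For
      \<open>\<psi> S\<close> it fails, since \<open>r \<otimes> s\<close> lies outside
      \<open>\<phi> (Ann R M S)\<close>, which contains \<open>Ann R M (\<psi> S)\<close>.\<close>
    have scale: "scale_set M s X \<subseteq> K \<longleftrightarrow> r \<otimes> s \<in> Ann R M X" if "X \<subseteq> carrier M" for X
      using scale_set_subset_annihilated_iff[OF that rs(2), of "{r}"] rs(1,2)
      by (simp add: K_def R.m_comm)
    have "scale_set M s S \<subseteq> K" "\<not> scale_set M s (\<psi> S) \<subseteq> K"
      using rs(3) Ann scale[OF SM] scale[OF sub] by auto
    then have "S \<subseteq> K \<or> scale_set M s S = {\<zero>\<^bsub>M\<^esub>}"
      using second K rs(2) unfolding psi_second_def by blast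
    moreover have "r \<in> Ann R M S" if "S \<subseteq> K"
      using that rs(1) by (auto simp: K_def annihilated_def Ann_def)
    ultimately show ?thesis
      using scale_set_eq_zero_iff[OF S(1) rs(2)] by blast
  qed
  then show ?thesis
    using Ann_ideal[OF SM] Ann_eq_carrier_iff[OF S(1)] S(2) by (auto simp: phi_prime_def)
qed

end

text \<open>An element \<open>b \<in> I\<close> with \<open>r b \<in> \<phi>(P)\<close> is handled by replacing it with \<open>a + b\<close>, because
  \<open>r (a + b) \<notin> \<phi>(P)\<close>.\<close>

lemma (in cring) phi_prime_ideal_subset:
  assumes prime: "phi_prime R \<phi> P" and \<phi>: "ideal (\<phi> P) R \<or> \<phi> P = {}"
    and I: "ideal I R" and r: "r \<in> carrier R" "r \<notin> P"
    and rI: "\<And>b. b \<in> I \<Longrightarrow> r \<otimes> b \<in> P"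
    and a: "a \<in> I" "r \<otimes> a \<notin> \<phi> P"
  shows "I \<subseteq> P"
proof
  interpret I: ideal I R by (rule I)
  interpret P: ideal P R using prime by (simp add: phi_prime_def)
  have mem: "b \<in> P" if "b \<in> I" "r \<otimes> b \<notin> \<phi> P" for b
    using that prime r rI[OF that(1)] I.a_subset unfolding phi_prime_def by blast
  fix b assume b: "b \<in> I"
  have carr: "a \<in> carrier R" "b \<in> carrier R" using a(1) b I.a_subset by auto
  show "b \<in> P"
  proof (cases "r \<otimes> b \<in> \<phi> P")
    case True
    \<comment> \<open>Having a member, \<open>\<phi> P\<close> is not the empty value, hence an
      ideal: subtracting \<open>r \<otimes> b\<close> from \<open>r \<otimes> (a \<oplus> b)\<close>
      would put \<open>r \<otimes> a\<close> into it.\<close>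
    then interpret \<phi>P: ideal "\<phi> P" R using \<phi> by blast
    have diff: "(x \<oplus> y) \<ominus> y = x" if "x \<in> carrier R" "y \<in> carrier R" for x y
      using that by algebra
    have "r \<otimes> (a \<oplus> b) \<notin> \<phi> P"
    proof
      assume "r \<otimes> (a \<oplus> b) \<in> \<phi> P"
      then have "(r \<otimes> a \<oplus> r \<otimes> b) \<ominus> r \<otimes> b \<in> \<phi> P"
        using True carr r(1) by (simp add: r_distr a_minus_def)
      then show False using a(2) carr r(1) by (simp add: diff)
    qed
    \<comment> \<open>Both \<open>a \<oplus> b\<close> and \<open>a\<close> fall under
      \<open>mem\<close>, and \<open>b\<close> is their difference.\<close>
    then have "a \<oplus> b \<in> P" using mem a(1) b by simp
    moreover have "a \<in> P" using mem a by blast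
    ultimately have "(b \<oplus> a) \<ominus> a \<in> P"
      using carr by (simp add: a_minus_def a_comm)
    then show ?thesis using carr by (simp add: diff)
  qed (use mem b in blast)
qed

text \<open>If \<open>\<phi>\<close> takes the empty value here, \<open>\<psi> S\<close> is all of
  \<open>carrier M\<close>, and the same argument applies.\<close>

lemma phi_prime_Ann_imp_psi_second:
  assumes comult: "comultiplication_module R M" and S: "submodule S R M"
    and \<psi>: "\<psi> S = annihilated M (\<phi> (Ann R M S))"
    and prime: "phi_prime R \<phi> (Ann R M S)"
    and \<phi>: "ideal (\<phi> (Ann R M S)) R \<or> \<phi> (Ann R M S) = {}"
  shows "psi_second R M \<psi> S"
proof -
  interpret module R M using comult by (simp add: comultiplication_module_def)
  note SM = submoduleE(1)[OF S]
  have "S \<subseteq> K \<or> scale_set M r S = {\<zero>\<^bsub>M\<^esub>}"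
    if r: "r \<in> carrier R" and K: "K \<in> submodules R M"
      and rS: "scale_set M r S \<subseteq> K" and r\<psi>: "\<not> scale_set M r (\<psi> S) \<subseteq> K" for r K
  proof (cases "r \<in> Ann R M S")
    case True
    then show ?thesis using scale_set_eq_zero_iff[OF S r] by blast
  next
    case False
    obtain I where I: "ideal I R" "K = annihilated M I"
      using comult K by (auto simp: comultiplication_module_def ideals_def)
    have IR: "I \<subseteq> carrier R"
      using additive_subgroup.a_subset[OF ideal.axioms(1)[OF I(1)]] .
    have \<psi>M: "\<psi> S \<subseteq> carrier M" by (auto simp: \<psi> annihilated_def)
    have rI: "\<And>b. b \<in> I \<Longrightarrow> r \<otimes>\<^bsub>R\<^esub> b \<in> Ann R M S"
      using rS scale_set_subset_annihilated_iff[OF SM r IR] I(2) by blast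
    obtain a where a: "a \<in> I" "r \<otimes>\<^bsub>R\<^esub> a \<notin> Ann R M (\<psi> S)"
      using r\<psi> scale_set_subset_annihilated_iff[OF \<psi>M r IR] I(2) by blast
    \<comment> \<open>Every element of \<open>\<phi> (Ann R M S)\<close> kills
      \<open>\<psi> S\<close>, by the choice of \<open>\<psi> S\<close>.\<close>
    have "r \<otimes>\<^bsub>R\<^esub> a \<notin> \<phi> (Ann R M S)"
      using a r IR by (auto simp: \<psi> annihilated_def Ann_def)
    then have "I \<subseteq> Ann R M S"
      using R.phi_prime_ideal_subset[OF prime \<phi> I(1) r False rI a(1)] by blast
    \<comment> \<open>Either inclusion says that each element of \<open>I\<close> kills each element
      of \<open>S\<close>.\<close>
    then have "S \<subseteq> K" using SM by (auto simp: I(2) annihilated_def Ann_def)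
    then show ?thesis ..
  qed
  moreover have "S \<noteq> {\<zero>\<^bsub>M\<^esub>}"
    using prime Ann_eq_carrier_iff[OF S] by (auto simp: phi_prime_def)
  ultimately show ?thesis using S by (auto simp: psi_second_def)
qed

theorem theorem2p9:
  fixes R :: "('a, 'r) ring_scheme"
    and M :: "('a, 'b, 'm) module_scheme"
    and \<psi> :: "'b set \<Rightarrow> 'b set"
    and \<phi> :: "'a set \<Rightarrow> 'a set"
  assumes "module R M"
    and "\<psi> \<in> submodules R M \<rightarrow> submodules R M \<union> {{}}"
    and "\<phi> \<in> ideals R \<rightarrow> ideals R \<union> {{}}"
  shows "(\<forall>S. psi_second R M \<psi> S \<and> Ann R M (\<psi> S) \<subseteq> \<phi> (Ann R M S)
            \<longrightarrow> phi_prime R \<phi> (Ann R M S)) \<and>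
         (\<forall>S. comultiplication_module R M \<and> submodule S R M \<and>
              \<psi> S = annihilated M (\<phi> (Ann R M S)) \<and> phi_prime R \<phi> (Ann R M S)
            \<longrightarrow> psi_second R M \<psi> S)"
proof (intro conjI allI impI; elim conjE)
  interpret module R M by fact
  fix S assume S: "psi_second R M \<psi> S" "Ann R M (\<psi> S) \<subseteq> \<phi> (Ann R M S)"
  then have "S \<in> submodules R M" by (simp add: psi_second_def submodules_def)
  then have "\<psi> S \<in> submodules R M \<union> {{}}" using assms(2) by (rule funcset_mem[rotated])
  then have "\<psi> S \<subseteq> carrier M" using submoduleE(1) by (auto simp: submodules_def)
  then show "phi_prime R \<phi> (Ann R M S)" using S psi_second_imp_phi_prime_Ann by blast
next
  fix S assume S: "comultiplication_module R M" "submodule S R M"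
    "\<psi> S = annihilated M (\<phi> (Ann R M S))" "phi_prime R \<phi> (Ann R M S)"
  \<comment> \<open>\<open>phi_prime\<close> includes being an ideal, so the assumption on the
    values of \<open>\<phi>\<close> applies to \<open>Ann R M S\<close>.\<close>
  then have "Ann R M S \<in> ideals R" by (simp add: phi_prime_def ideals_def)
  then have "\<phi> (Ann R M S) \<in> ideals R \<union> {{}}" using assms(3) by (rule funcset_mem[rotated])
  then have "ideal (\<phi> (Ann R M S)) R \<or> \<phi> (Ann R M S) = {}" by (auto simp: ideals_def)
  with S show "psi_second R M \<psi> S"
    by (rule phi_prime_Ann_imp_psi_second[where \<psi> = \<psi> and \<phi> = \<phi> and S = S])
qed

end
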